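(* Let $(m,n)$ be a coprime pair of positive integers, let $D\in\mathcal D_{m,n}$ and let $\Sigma$ be the $(S,W)$-word of $D$. Let $R=(r_1,r_2,\dots,r_{m+n})$ be a weakly increasing sequence of integers with $r_1=0$. Then $R$ is a rearrangement of the rank sequence of some pre-image $\overline D$ of $D$ under the sweep map if and only if the path diagram $T(\Sigma,R)$ is balanced and $R$ is strictly increasing.
   Context: An $(m,n)$-Dyck path is a lattice path from $(0,0)$ to $(m,n)$ made of $n$ North steps $(0,1)$ and $m$ East steps $(1,0)$ that stays weakly above the line $y=nx/m$; $\mathcal D_{m,n}$ is the set of such paths. The rank of a vertex is computed along the path starting with rank $0$ at $(0,0)$, adding $m$ after each North step and subtracting $n$ after each East step (so $(x,y)$ has rank $my-nx$); a path is an $(m,n)$-Dyck path iff all its ranks are nonnegative. The rank sequence of a path is the sequence of ranks of the starting points of its $m+n$ steps, in order along the path. The $(S,W)$-word of a path is obtained by writing $S$ for each North step and $W$ for each East step, in order. The sweep map sends $\overline D\in\mathcal D_{m,n}$ to the path $D$ whose steps are the steps of $\overline D$ rearranged in increasing order of the ranks of their starting points; $\overline D$ is then called a pre-image of $D$. Path diagram: given a word $\Sigma=\Sigma_1\cdots\Sigma_{m+n}$ in letters $S,W$ and an integer sequence $R=(r_1,\dots,r_{m+n})$, $T(\Sigma,R)$ consists of arrows $A_1,\dots,A_{m+n}$, where $A_i$ goes from $(i-1,r_i)$ to $(i,r_i+m)$ (red) if $\Sigma_i=S$ and from $(i-1,r_i)$ to $(i,r_i-n)$ (blue) if $\Sigma_i=W$.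 For an integer $j$, row $j$ is the strip between $y=j$ and $y=j+1$; a red arrow with starting rank $r$ has a segment in rows $r,\dots,r+m-1$, a blue arrow with starting rank $r$ has a segment in rows $r-n,\dots,r-1$. With $c^r(j)$, $c^b(j)$ the numbers of red, blue arrows having a segment in row $j$, the row count is $c(j)=c^r(j)-c^b(j)$. $T(\Sigma,R)$ is balanced if $c(j)=0$ for every integer $j$. *)

theory Defs
  imports Complex_Main "HOL-Library.Multiset"
begin

datatype step = North | East

datatype letter = S | W

text \<open>The vertex reached after \<open>k\<close> steps is
  \<open>(count_list (take k P) East, count_list (take k P) North)\<close>; since the line is straight and the
  steps are segments, it suffices to constrain the vertices.\<close>

definition dyck_paths :: "nat \<Rightarrow> nat \<Rightarrow> step list set" where
  "dyck_paths m n =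
    {P. count_list P North = n \<and> count_list P East = m \<and>
        (\<forall>k \<le> length P. real (count_list (take k P) North)
                        \<ge> real n * real (count_list (take k P) East) / real m)}"

fun next_rank :: "nat \<Rightarrow> nat \<Rightarrow> int \<Rightarrow> step \<Rightarrow> int" where
  "next_rank m n r North = r + int m"
| "next_rank m n r East = r - int n"

primrec ranks_from :: "nat \<Rightarrow> nat \<Rightarrow> int \<Rightarrow> step list \<Rightarrow> int list" where
  "ranks_from m n r [] = []"
| "ranks_from m n r (s # P) = r # ranks_from m n (next_rank m n r s) P"

text \<open>Only the starting points of the steps are recorded, so the final vertex is left out.\<close>

definition rank_sequence :: "nat \<Rightarrow> nat \<Rightarrow> step list \<Rightarrow> int list" where
  "rank_sequence m n P = ranks_from m n 0 P"

fun step_letter :: "step \<Rightarrow> letter" where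
  "step_letter North = S"
| "step_letter East = W"

definition sw_word :: "step list \<Rightarrow> letter list" where
  "sw_word P = map step_letter P"

text \<open>For coprime \<open>m\<close> and \<open>n\<close> the starting ranks of an \<open>(m,n)\<close>-Dyck path are pairwise distinct, so
  the stability of \<open>sort_key\<close> plays no role.\<close>

definition sweep :: "nat \<Rightarrow> nat \<Rightarrow> step list \<Rightarrow> step list" where
  "sweep m n P = map snd (sort_key fst (zip (rank_sequence m n P) P))"

datatype colour = Red | Blue

datatype arrow = Arrow (colour: colour) (source: "int \<times> int") (target: "int \<times> int")

text \<open>Lists are indexed from 0: entry \<open>i\<close> is the arrow \<open>A\<^bsub>i+1\<^esub>\<close>, which starts at abscissa \<open>i\<close>.\<close>

definition path_diagram :: "nat \<Rightarrow> nat \<Rightarrow> letter list \<Rightarrow> int list \<Rightarrow> arrow list" where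
  "path_diagram m n \<Sigma> R =
    map (\<lambda>i. case \<Sigma> ! i of
               S \<Rightarrow> Arrow Red (int i, R ! i) (int i + 1, R ! i + int m)
             | W \<Rightarrow> Arrow Blue (int i, R ! i) (int i + 1, R ! i - int n))
        [0..<length \<Sigma>]"

text \<open>Row \<open>j\<close> is the strip between heights \<open>j\<close> and \<open>j + 1\<close>; red arrows go up, blue arrows go down.\<close>

definition has_segment_in_row :: "arrow \<Rightarrow> int \<Rightarrow> bool" where
  "has_segment_in_row A j \<longleftrightarrow>
    (case colour A of
       Red \<Rightarrow> j \<in> {snd (source A) .. snd (target A) - 1}
     | Blue \<Rightarrow> j \<in> {snd (target A) .. snd (source A) - 1})"

definition colour_row_count :: "colour \<Rightarrow> arrow list \<Rightarrow> int \<Rightarrow> nat" where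
  "colour_row_count c T j = length (filter (\<lambda>A. colour A = c \<and> has_segment_in_row A j) T)"

definition row_count :: "arrow list \<Rightarrow> int \<Rightarrow> int" where
  "row_count T j = int (colour_row_count Red T j) - int (colour_row_count Blue T j)"

definition balanced :: "arrow list \<Rightarrow> bool" where
  "balanced T \<longleftrightarrow> (\<forall>j::int. row_count T j = 0)"

end

theory Submission
  imports Defs
begin

text \<open>An arrow with starting rank \<open>r\<close> and final rank \<open>t\<close> contributes \<open>[r \<le> j] - [t \<le> j]\<close> to the
  count of row \<open>j\<close>, whatever its colour. Hence the diagram is balanced if and only if the final
  ranks of its arrows are a rearrangement of \<open>R\<close>. For the ranks of a closed path this holds by
  telescoping. Conversely, if \<open>R\<close> is strict and the final ranks lie in \<open>R\<close>, follow the arrows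
  for \<open>m + n\<close> steps, starting at rank \<open>0\<close>. By coprimality, fewer than \<open>m + n\<close> steps never return
  to the same rank, so the \<open>m + n\<close> ranks met are distinct and exhaust \<open>R\<close>; the path obtained is the
  pre-image sought.\<close>

lemma length_eq_count_North_East: "length P = count_list P North + count_list P East"
proof (induction P)
  case (Cons s P)
  then show ?case by (cases s) auto
qed simp

lemma length_ranks_from [simp]: "length (ranks_from m n r P) = length P"
  by (induction P arbitrary: r) auto

lemma nth_ranks_from:
  "k < length P \<Longrightarrow> ranks_from m n r P ! k =
     r + int m * int (count_list (take k P) North) - int n * int (count_list (take k P) East)"
proof (induction P arbitrary: r k)
  case (Cons s P)
  show ?case
  proof (cases k)
    case (Suc i)
    then show ?thesis
      using Cons.prems Cons.IH[of i "next_rank m n r s"] by (cases s) (auto simp: algebra_simps)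
  qed simp
qed simp

text \<open>Each step ends where the next one starts. For a closed path the extra entries at the two
  ends agree and cancel, so final and starting ranks form the same multiset.\<close>

lemma ranks_from_shift:
  "r # map (case_prod (next_rank m n)) (zip (ranks_from m n r P) P) =
     ranks_from m n r P @
       [r + int m * int (count_list P North) - int n * int (count_list P East)]"
proof (induction P arbitrary: r)
  case (Cons s P)
  show ?case using Cons[of "next_rank m n r s"]
    by (cases s) (auto simp: algebra_simps)
qed simp

text \<open>Coprimality gives \<open>n dvd a\<close> and \<open>m dvd b\<close>; the equation forces
  both \<open>a\<close> and \<open>b\<close> to be positive as soon as one is.\<close>

lemma coprime_mult_eq_imp_le:
  fixes m n a b :: nat
  assumes "m > 0" "n > 0" "coprime m n" and eq: "m * a = n * b" and pos: "a + b > 0"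
  shows "m + n \<le> a + b"
proof -
  have "n dvd a"
    using assms(3) eq by (metis coprime_commute coprime_dvd_mult_right_iff dvd_triv_left)
  moreover have "m dvd b"
    using assms(3) eq by (metis coprime_dvd_mult_right_iff dvd_triv_left)
  moreover have "a > 0" "b > 0"
    using assms by (metis add.right_neutral mult_0_right mult_is_0 neq0_conv add_0)+
  ultimately have "n \<le> a" "m \<le> b" by (simp_all add: dvd_imp_le)
  then show ?thesis by simp
qed

text \<open>Equal ranks at two starting points would enclose a nonempty segment with zero rank
  change, hence of at least \<open>m + n\<close> steps, yet shorter than \<open>P\<close>. Stated
  for any short enough path, this also covers a walk not yet known to be a Dyck path.\<close>

lemma distinct_ranks_from:
  assumes "m > 0" "n > 0" "coprime m n" and len: "length P \<le> m + n"
  shows "distinct (ranks_from m n r P)"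
proof -
  have "ranks_from m n r P ! i \<noteq> ranks_from m n r P ! j" if ij: "i < j" "j < length P" for i j
  proof
    assume eq: "ranks_from m n r P ! i = ranks_from m n r P ! j"
    define Q where "Q = take (j - i) (drop i P)"
    have tj: "take j P = take i P @ Q"
      unfolding Q_def using ij(1) by (metis le_add_diff_inverse less_imp_le take_add)
    have lenQ: "length Q = j - i" unfolding Q_def using ij by simp
    have "int m * int (count_list Q North) = int n * int (count_list Q East)"
      using eq ij by (simp add: nth_ranks_from tj algebra_simps)
    then have "m * count_list Q North = n * count_list Q East"
      by (metis of_nat_eq_iff of_nat_mult)
    then have "m + n \<le> count_list Q North + count_list Q East"
      by (rule coprime_mult_eq_imp_le[OF assms(1-3)])
        (use lenQ ij length_eq_count_North_East[of Q] in simp)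
    then show False using lenQ length_eq_count_North_East[of Q] len ij by simp
  qed
  then show ?thesis
    by (simp add: distinct_conv_nth) (metis nat_neq_iff)
qed

text \<open>The multiplicity of \<open>j\<close> is the difference of the counts at \<open>j\<close>
  and \<open>j - 1\<close>.\<close>

lemma mset_eq_iff_card_le:
  fixes xs ys :: "int list"
  shows "mset xs = mset ys \<longleftrightarrow>
    (\<forall>j. length (filter (\<lambda>x. x \<le> j) xs) = length (filter (\<lambda>x. x \<le> j) ys))"
proof
  assume "mset xs = mset ys"
  then show "\<forall>j. length (filter (\<lambda>x. x \<le> j) xs) = length (filter (\<lambda>x. x \<le> j) ys)"
    by (metis mset_filter size_mset)
next
  have split: "length (filter (\<lambda>x. x \<le> j) zs) =
      length (filter (\<lambda>x. x \<le> j - 1) zs) + count (mset zs) j" for zs :: "int list" and j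
    by (induction zs) auto
  assume "\<forall>j. length (filter (\<lambda>x. x \<le> j) xs) = length (filter (\<lambda>x. x \<le> j) ys)"
  then have "count (mset xs) j = count (mset ys) j" for j
    using split[of j xs] split[of j ys] by (metis add_left_cancel)
  then show "mset xs = mset ys" by (simp add: multiset_eq_iff)
qed

lemma row_count_Cons:
  "row_count (A # T) j = row_count T j +
     (if snd (source A) \<le> j \<and> j < snd (target A) \<and> colour A = Red then 1
      else if snd (target A) \<le> j \<and> j < snd (source A) \<and> colour A = Blue then -1 else 0)"
  by (cases "colour A") (auto simp: row_count_def colour_row_count_def has_segment_in_row_def)

lemma row_count_Nil [simp]: "row_count [] j = 0"
  by (simp add: row_count_def colour_row_count_def)

definition step_arrow :: "nat \<Rightarrow> nat \<Rightarrow> nat \<Rightarrow> int \<Rightarrow> step \<Rightarrow> arrow" where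
  "step_arrow m n i r s =
     Arrow (case s of North \<Rightarrow> Red | East \<Rightarrow> Blue) (int i, r) (int i + 1, next_rank m n r s)"

lemma path_diagram_sw_word:
  "path_diagram m n (sw_word D) R = map (\<lambda>i. step_arrow m n i (R ! i) (D ! i)) [0..<length D]"
proof -
  have "(case step_letter s of
           S \<Rightarrow> Arrow Red (int i, r) (int i + 1, r + int m)
         | W \<Rightarrow> Arrow Blue (int i, r) (int i + 1, r - int n)) = step_arrow m n i r s" for i r s
    by (cases s) (auto simp: step_arrow_def)
  then show ?thesis by (auto simp: path_diagram_def sw_word_def)
qed

text \<open>For a red arrow from rank \<open>r\<close> to \<open>t\<close> the two indicators differ
  exactly when \<open>r \<le> j < t\<close>, for a blue one exactly when
  \<open>t \<le> j < r\<close>: these are the rows it crosses.\<close>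

lemma row_count_step_arrows:
  "row_count (map (\<lambda>i. step_arrow m n i (f i) (g i)) is) j =
     int (length (filter (\<lambda>x. x \<le> j) (map f is))) -
     int (length (filter (\<lambda>x. x \<le> j) (map (\<lambda>i. next_rank m n (f i) (g i)) is)))"
proof (induction "is")
  case (Cons i "is")
  then show ?case by (cases "g i") (auto simp: row_count_Cons step_arrow_def)
qed simp

lemma balanced_path_diagram_iff:
  assumes "length R = length D"
  shows "balanced (path_diagram m n (sw_word D) R) \<longleftrightarrow>
    mset R = mset (map (case_prod (next_rank m n)) (zip R D))"
proof -
  have "map (\<lambda>i. R ! i) [0..<length D] = R"
    by (metis assms map_nth)
  moreover have "map (\<lambda>i. next_rank m n (R ! i) (D ! i)) [0..<length D] =
      map (case_prod (next_rank m n)) (zip R D)"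
    using assms by (auto intro!: nth_equalityI)
  ultimately show ?thesis
    unfolding balanced_def path_diagram_sw_word row_count_step_arrows mset_eq_iff_card_le
    by simp
qed

text \<open>This follows the arrows of a diagram: \<open>g\<close> is meant to give the only step
  leaving each rank.\<close>

primrec walk :: "nat \<Rightarrow> nat \<Rightarrow> (int \<Rightarrow> step) \<Rightarrow> nat \<Rightarrow> int \<Rightarrow> step list" where
  "walk m n g 0 r = []"
| "walk m n g (Suc k) r = g r # walk m n g k (next_rank m n r (g r))"

lemma length_walk [simp]: "length (walk m n g k r) = k"
  by (induction k arbitrary: r) auto

lemma walk_eq_map_ranks: "walk m n g k r = map g (ranks_from m n r (walk m n g k r))"
  by (induction k arbitrary: r) auto

lemma set_ranks_from_walk_subset:
  assumes "\<And>r. r \<in> A \<Longrightarrow> next_rank m n r (g r) \<in> A"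
  shows "r \<in> A \<Longrightarrow> set (ranks_from m n r (walk m n g k r)) \<subseteq> A"
  by (induction k arbitrary: r) (auto intro: assms)

lemma dyck_paths_iff_ranks_nonneg:
  assumes "m > 0"
  shows "P \<in> dyck_paths m n \<longleftrightarrow>
    count_list P North = n \<and> count_list P East = m \<and> (\<forall>r \<in> set (rank_sequence m n P). 0 \<le> r)"
proof -
  have *: "real a \<ge> real n * real b / real m \<longleftrightarrow> 0 \<le> int m * int a - int n * int b" for a b
  proof -
    have "real a \<ge> real n * real b / real m \<longleftrightarrow> real (n * b) \<le> real (m * a)"
      using assms by (simp add: field_simps)
    also have "\<dots> \<longleftrightarrow> n * b \<le> m * a" by (rule of_nat_le_iff)
    also have "\<dots> \<longleftrightarrow> int (n * b) \<le> int (m * a)" by (rule of_nat_le_iff[symmetric])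
    finally show ?thesis by simp
  qed
  \<comment> \<open>The case \<open>k = length P\<close> has no entry in
    \<open>rank_sequence\<close>; there the rank is \<open>m * n - n * m = 0\<close>.\<close>
  have "(\<forall>k \<le> length P. 0 \<le> int m * int (count_list (take k P) North)
                             - int n * int (count_list (take k P) East))
      \<longleftrightarrow> (\<forall>r \<in> set (rank_sequence m n P). 0 \<le> r)"
    if "count_list P North = n" "count_list P East = m"
    using that by (auto simp: rank_sequence_def all_set_conv_all_nth nth_ranks_from le_less)
  then show ?thesis unfolding dyck_paths_def * by auto
qed

lemma length_dyck_path: "P \<in> dyck_paths m n \<Longrightarrow> length P = m + n"
  using length_eq_count_North_East[of P] by (auto simp: dyck_paths_def)

theorem theorem1:
  fixes m n :: nat and D :: "step list" and R :: "int list"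
  assumes "m > 0" and "n > 0" and "coprime m n"
    and "D \<in> dyck_paths m n"
    and "length R = m + n" and "sorted R" and "R ! 0 = 0"
  shows "(\<exists>D'. D' \<in> dyck_paths m n \<and> sweep m n D' = D \<and> mset R = mset (rank_sequence m n D'))
    \<longleftrightarrow> balanced (path_diagram m n (sw_word D) R) \<and> sorted_wrt (<) R"
proof -
  have lenD: "length D = m + n" using assms(4) by (rule length_dyck_path)
  then have lenRD: "length R = length D" using assms(5) by simp
  show ?thesis
  proof
    assume "\<exists>D'. D' \<in> dyck_paths m n \<and> sweep m n D' = D \<and> mset R = mset (rank_sequence m n D')"
    then obtain D' where D': "D' \<in> dyck_paths m n" "sweep m n D' = D"
      "mset R = mset (rank_sequence m n D')" by blast
    let ?Q = "rank_sequence m n D'"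
    have lenQ: "length ?Q = length D'" by (simp add: rank_sequence_def)
    have "distinct ?Q"
      unfolding rank_sequence_def
      by (rule distinct_ranks_from[OF assms(1-3)]) (simp add: length_dyck_path[OF D'(1)])
    then have "distinct R" using D'(3) mset_eq_imp_distinct_iff by blast
    then have strict: "sorted_wrt (<) R" using assms(6) by (simp add: strict_sorted_iff)
    \<comment> \<open>\<open>sweep\<close> forgets the sorted ranks; \<open>Z\<close> keeps them, so
      that \<open>R\<close> and \<open>D\<close> are recovered together as its two
      projections.\<close>
    define Z where "Z = sort_key fst (zip ?Q D')"
    have "mset (map fst Z) = mset (map fst (zip ?Q D'))"
      unfolding mset_map by (simp add: Z_def)
    also have "\<dots> = mset R" using lenQ D'(3) by simp
    finally have "mset (map fst Z) = mset R" .
    moreover have "sorted (map fst Z)" by (simp add: Z_def)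
    ultimately have "map fst Z = R"
      using assms(6) by (metis properties_for_sort)
    moreover have "map snd Z = D" using D'(2) by (simp add: Z_def sweep_def)
    ultimately have Z: "zip R D = Z" by (metis zip_map_fst_snd)
    have "mset (zip R D) = mset (zip ?Q D')" unfolding Z Z_def by simp
    then have "mset (map (case_prod (next_rank m n)) (zip R D)) =
        mset (map (case_prod (next_rank m n)) (zip ?Q D'))" by simp
    \<comment> \<open>The path \<open>D'\<close> returns to rank 0, so the entries added at both
      ends in \<open>ranks_from_shift\<close> are 0.\<close>
    moreover have "mset (map (case_prod (next_rank m n)) (zip ?Q D')) = mset ?Q"
      using arg_cong[OF ranks_from_shift[of 0 m n D'], of mset] D'(1)
      by (simp add: rank_sequence_def dyck_paths_def mult.commute)
    ultimately show "balanced (path_diagram m n (sw_word D) R) \<and> sorted_wrt (<) R"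
      using strict D'(3) by (simp add: balanced_path_diagram_iff[OF lenRD])
  next
    assume *: "balanced (path_diagram m n (sw_word D) R) \<and> sorted_wrt (<) R"
    then have dR: "distinct R" by (simp add: strict_sorted_iff)
    \<comment> \<open>\<open>g\<close> reads off the step that \<open>D\<close> attaches to a rank,
      unambiguous since \<open>R\<close> is distinct. Outside \<open>R\<close> its value is
      arbitrary, but the walk below never leaves \<open>R\<close>.\<close>
    define g where "g = (\<lambda>r. the (map_of (zip R D) r))"
    have g: "map g R = D"
      using dR lenRD by (auto simp: g_def map_of_zip_nth intro!: nth_equalityI)
    have zipRD: "zip R D = map (\<lambda>r. (r, g r)) R"
      unfolding g[symmetric] by (simp add: zip_map2 zip_same_conv_map)
    have "mset R = mset (map (\<lambda>r. next_rank m n r (g r)) R)"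
      using * by (simp add: balanced_path_diagram_iff[OF lenRD] zipRD comp_def multiset.map_comp)
    then have "set R = (\<lambda>r. next_rank m n r (g r)) ` set R"
      by (metis set_map set_mset_mset)
    then have closed: "next_rank m n r (g r) \<in> set R" if "r \<in> set R" for r
      using that by blast
    have zero: "0 \<in> set R" using assms(1,5,7) by (metis add_gr_0 nth_mem)
    \<comment> \<open>The number of steps is the length of \<open>R\<close> and also the largest
      allowed by \<open>distinct_ranks_from\<close>.\<close>
    define P where "P = walk m n g (m + n) 0"
    let ?Q = "rank_sequence m n P"
    have lenQ: "length ?Q = m + n" by (simp add: rank_sequence_def P_def)
    have dQ: "distinct ?Q"
      unfolding rank_sequence_def
      by (rule distinct_ranks_from[OF assms(1-3)]) (simp add: P_def)
    have "set ?Q \<subseteq> set R"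
      unfolding rank_sequence_def P_def by (rule set_ranks_from_walk_subset[OF closed zero])
    moreover have "card (set ?Q) = card (set R)"
      using dQ dR lenQ assms(5) by (simp add: distinct_card)
    ultimately have setQ: "set ?Q = set R" by (simp add: card_subset_eq)
    then have mQ: "mset R = mset ?Q" using dQ dR by (simp add: set_eq_iff_mset_eq_distinct)
    have P: "P = map g ?Q"
      unfolding rank_sequence_def P_def by (rule walk_eq_map_ranks)
    \<comment> \<open>\<open>P\<close> and \<open>D\<close> are images under \<open>g\<close> of
      rearrangements of the same ranks, so they have equally many steps of each kind.\<close>
    have "mset P = image_mset g (mset ?Q)" by (subst P) simp
    then have "mset P = mset D" unfolding g[symmetric] mQ[symmetric] by simp
    then have "count_list P s = count_list D s" for s by (metis count_mset)
    moreover have "0 \<le> r" if r: "r \<in> set R" for r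
    proof -
      obtain i where "i < length R" "r = R ! i" using r by (metis in_set_conv_nth)
      then show ?thesis using sorted_nth_mono[OF assms(6), of 0 i] assms(7) by simp
    qed
    ultimately have "P \<in> dyck_paths m n"
      using assms(4) setQ by (simp add: dyck_paths_iff_ranks_nonneg[OF assms(1)])
    \<comment> \<open>The keys are injective, so the sorted list is determined by its multiset of
      pairs.\<close>
    moreover have "sort_key fst (zip ?Q P) = zip R D"
    proof (rule sort_key_inj_key_eq)
      have "zip ?Q P = map (\<lambda>r. (r, g r)) ?Q"
        by (rule trans[OF arg_cong[OF P]]) (simp add: zip_map2 zip_same_conv_map)
      then show "mset (zip ?Q P) = mset (zip R D)" and "inj_on fst (set (zip ?Q P))"
        using mQ by (auto simp: zipRD inj_on_def)
      show "sorted (map fst (zip R D))" using lenRD assms(6) by simp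
    qed
    then have "sweep m n P = D" using lenRD by (simp add: sweep_def)
    ultimately show "\<exists>D'. D' \<in> dyck_paths m n \<and> sweep m n D' = D \<and>
        mset R = mset (rank_sequence m n D')"
      using mQ by blast
  qed
qed

end
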